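(* The graph of the function $y=f(x)$ has the tangent at the point $A$ of the graph with abscissa $x_0$ if and only if $f(x)$ has the extended derivative at $x_0$, and in this case the slope of the tangent is $f'(x_0)$ (where $f'(x_0)$ denotes the extended derivative, possibly $\infty$).
   Context: Here $f$ is a real function of one real variable and its graph is regarded as a curve in the plane. Definition of tangent. Let $L$ be a curve and $A\in L$. Consider an arc of $L$ containing $A$ which is divided by $A$ into two parts $L_1$ and $L_2$ such that $L_1$ and $L_2$ intersect only at $A$, and in each part there always exist points that are not $A$. For each point $M\in L$, $M\neq A$, the secant line $AM$ has the unit vector $\overrightarrow{AM}/|\overrightarrow{AM}|$. If the limits $$\lim_{M\to A,\ M\in L_1}\frac{\overrightarrow{AM}}{|\overrightarrow{AM}|}\quad\text{and}\quad \lim_{M\to A,\ M\in L_2}\frac{\overrightarrow{AM}}{|\overrightarrow{AM}|}$$ exist and are collinear vectors, then $L$ is said to have the tangent at $A$, and both these limits are direction vectors of this tangent (the line through $A$ with this direction). Extended derivative. Put $\Delta x=x-x_0$ and $\Delta y=f(x)-f(x_0)$. The extended derivative of $y=f(x)$ at $x_0$ is the finite or infinite limit $\lim_{\Delta x\to0}\frac{\Delta y}{\Delta x}$; $f$ has the extended derivative at $x_0$ if this limit is finite or infinite. In the finite case $f'(x_0)$ is this limit (the ordinary derivative). In the infinite case each of the one-sided limits $\lim_{\Delta x\to0^+}\frac{\Delta y}{\Delta x}$ and $\lim_{\Delta x\to0^-}\frac{\Delta y}{\Delta x}$ is $+\infty$ or $-\infty$, the two signs being allowed to differ, and one writes $f'(x_0)=\infty$.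 A line parallel to the vertical axis is said to have infinite slope $\infty$; a line with direction vector $(1,m)$ has slope $m$. *)

theory Defs
  imports "HOL-Analysis.Analysis"
begin

text \<open>Curves are sets of points of the Euclidean plane \<^typ>\<open>real \<times> real\<close>.\<close>

definition line_through :: "real \<times> real \<Rightarrow> real \<times> real \<Rightarrow> (real \<times> real) set" where
  "line_through P d = {P + s *\<^sub>R d | s. True}"

text \<open>
  An arc of \<open>L\<close> is the image of a continuous path in \<open>L\<close>, and \<open>A\<close> divides it at the
  parameter \<open>t\<close>. The path itself need not be injective; only the two parts
  have to meet in \<open>A\<close> alone. Each part is connected and contains a point other than \<open>A\<close>, so
  \<open>A\<close> is an accumulation point of both parts and neither limit below is vacuous.
  The limits \<open>d1\<close> and \<open>d2\<close> may be equal (a cusp) or opposite.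
\<close>

definition is_tangent :: "(real \<times> real) set \<Rightarrow> real \<times> real \<Rightarrow> (real \<times> real) set \<Rightarrow> bool" where
  "is_tangent L A T \<longleftrightarrow>
     (\<exists>g t L1 L2 d1 d2 d.
        path g \<and> path_image g \<subseteq> L \<and> t \<in> {0..1} \<and> g t = A \<and>
        L1 = g ` {0..t} \<and> L2 = g ` {t..1} \<and>
        L1 \<inter> L2 = {A} \<and> (\<exists>M\<in>L1. M \<noteq> A) \<and> (\<exists>M\<in>L2. M \<noteq> A) \<and>
        ((\<lambda>M. (M - A) /\<^sub>R norm (M - A)) \<longlongrightarrow> d1) (at A within L1) \<and>
        ((\<lambda>M. (M - A) /\<^sub>R norm (M - A)) \<longlongrightarrow> d2) (at A within L2) \<and>
        collinear {0, d1, d2} \<and>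
        d \<in> {d1, d2} \<and> T = line_through A d)"

definition has_tangent :: "(real \<times> real) set \<Rightarrow> real \<times> real \<Rightarrow> bool" where
  "has_tangent L A \<longleftrightarrow> (\<exists>T. is_tangent L A T)"

text \<open>Slopes and extended derivatives share a single unsigned infinite value.\<close>

datatype slope = Finite real | Infinite

fun has_slope :: "(real \<times> real) set \<Rightarrow> slope \<Rightarrow> bool" where
  "has_slope T (Finite m) \<longleftrightarrow> (\<exists>P. T = line_through P (1, m))"
| "has_slope T Infinite \<longleftrightarrow> (\<exists>P. T = line_through P (0, 1))"

definition diff_quot :: "(real \<Rightarrow> real) \<Rightarrow> real \<Rightarrow> real \<Rightarrow> real" where
  "diff_quot f x0 h = (f (x0 + h) - f x0) / h"

text \<open>In the infinite case the two one-sided limits may have different signs.\<close>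

fun has_ext_derivative :: "(real \<Rightarrow> real) \<Rightarrow> slope \<Rightarrow> real \<Rightarrow> bool" where
  "has_ext_derivative f (Finite l) x0 \<longleftrightarrow> (diff_quot f x0 \<longlongrightarrow> l) (at 0)"
| "has_ext_derivative f Infinite x0 \<longleftrightarrow>
     (filterlim (diff_quot f x0) at_top (at_right 0) \<or>
      filterlim (diff_quot f x0) at_bot (at_right 0)) \<and>
     (filterlim (diff_quot f x0) at_top (at_left 0) \<or>
      filterlim (diff_quot f x0) at_bot (at_left 0))"

definition ext_differentiable :: "(real \<Rightarrow> real) \<Rightarrow> real \<Rightarrow> bool" where
  "ext_differentiable f x0 \<longleftrightarrow> (\<exists>m. has_ext_derivative f m x0)"

definition fun_graph :: "real set \<Rightarrow> (real \<Rightarrow> real) \<Rightarrow> (real \<times> real) set" where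
  "fun_graph S f = {(x, f x) | x. x \<in> S}"

end

theory Submission
  imports Defs
begin

text \<open>
  Write \<open>q h\<close> for the difference quotient of \<open>f\<close> at \<open>x0\<close>. The unit vector of the secant from
  \<open>A = (x0, f x0)\<close> to the point of the graph over \<open>x0 + h\<close> is \<open>direction (q h)\<close> when \<open>h > 0\<close> and
  \<open>- direction (q h)\<close> when \<open>h < 0\<close>. So everything rests on two facts.

  The first turns limits along parts of an arc into one-sided limits in \<open>h\<close>. The projection to the
  horizontal axis is injective on the graph, so it maps the two parts of an arc that is divided by
  \<open>A\<close> to two nondegenerate intervals which share only \<open>x0\<close>; one of them lies to the right of
  \<open>x0\<close> and the other to the left (\<open>intervals_meeting_in_point\<close>). Continuity at \<open>x0\<close> makes
  \<open>M \<rightarrow> A\<close> in such a part the same as \<open>h \<rightarrow> 0\<close> from the corresponding side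
  (\<open>tendsto_within_graph_iff\<close>). Two collinear unit vectors are equal or opposite, so the graph has a
  tangent iff \<open>direction (q h)\<close> has one-sided limits \<open>e\<close> on the right and \<open>\<plusminus>e\<close> on the left, and
  \<open>e\<close> is then a direction of the tangent (\<open>is_tangent_graph_iff\<close>).

  The second compares the convergence of \<open>direction (q h)\<close> with that of \<open>q h\<close>. The map
  \<open>m \<mapsto> direction m\<close> is a homeomorphism of the extended real line onto the closed right half of the
  unit circle, the ends \<open>\<plusminus>\<infinity>\<close> corresponding to \<open>(0, \<plusminus>1)\<close>. If \<open>e\<close> is not vertical, its first
  coordinate is positive, which rules out \<open>-e\<close> as a limit on the left: both one-sided limits of
  \<open>q h\<close> are then finite and equal. If \<open>e\<close> is vertical, both are infinite with independent
  signs, exactly as the extended derivative permits.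
\<close>

section \<open>Slopes and unit directions\<close>

abbreviation direction :: "real \<Rightarrow> real \<times> real" where
  "direction m \<equiv> sgn (1, m)"

lemma tendsto_direction:
  fixes q :: "'a \<Rightarrow> real"
  assumes "(q \<longlongrightarrow> l) F"
  shows "((\<lambda>h. direction (q h)) \<longlongrightarrow> direction l) F"
  by (intro tendsto_sgn tendsto_Pair tendsto_const assms) (simp add: zero_prod_def)

text \<open>
  Eventually \<open>q h > 0\<close>, and rescaling by \<open>1 / q h\<close> then leaves \<open>sgn\<close> unchanged and turns \<open>(1, q h)\<close> into a
  convergent vector with nonzero limit.
\<close>

lemma tendsto_direction_at_top:
  fixes q :: "'a \<Rightarrow> real"
  assumes "filterlim q at_top F"
  shows "((\<lambda>h. direction (q h)) \<longlongrightarrow> (0, 1)) F"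
proof -
  have "((\<lambda>h. inverse (q h)) \<longlongrightarrow> 0) F"
    using assms by (rule tendsto_inverse_0_at_top)
  then have "((\<lambda>h. sgn (inverse (q h), 1::real)) \<longlongrightarrow> sgn (0, 1)) F"
    by (intro tendsto_sgn tendsto_Pair tendsto_const) (simp_all add: zero_prod_def)
  moreover have "\<forall>\<^sub>F h in F. sgn (inverse (q h), 1) = direction (q h)"
    using filterlim_at_top_dense[THEN iffD1, OF assms, rule_format, of 0]
  proof eventually_elim
    case (elim h)
    then have "(1, q h) = q h *\<^sub>R (inverse (q h), 1)" by simp
    then show ?case using elim by (metis scaleR_one sgn_pos sgn_scaleR)
  qed
  ultimately have "((\<lambda>h. direction (q h)) \<longlongrightarrow> sgn (0, 1)) F"
    by (rule Lim_transform_eventually)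
  then show ?thesis by (simp add: sgn_div_norm norm_Pair)
qed

lemma tendsto_direction_at_bot:
  fixes q :: "'a \<Rightarrow> real"
  assumes "filterlim q at_bot F"
  shows "((\<lambda>h. direction (q h)) \<longlongrightarrow> (0, -1)) F"
proof -
  have "filterlim (\<lambda>h. - q h) at_top F"
    using assms by (simp add: filterlim_uminus_at_bot)
  note lim = tendsto_direction_at_top[OF this]
  have "((\<lambda>h. (fst (direction (- q h)), - snd (direction (- q h)))) \<longlongrightarrow> (fst (0::real, 1::real), - snd (0::real, 1::real))) F"
    by (rule tendsto_Pair[OF tendsto_fst[OF lim] tendsto_minus[OF tendsto_snd[OF lim]]])
  then show ?thesis by (simp add: sgn_div_norm norm_Pair)
qed

lemma tendsto_direction_limit:
  fixes q :: "'a \<Rightarrow> real"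
  assumes "((\<lambda>h. direction (q h)) \<longlongrightarrow> e) F" and "F \<noteq> bot"
  shows "norm e = 1" and "0 \<le> fst e"
proof -
  have "((\<lambda>h. norm (direction (q h))) \<longlongrightarrow> norm e) F"
    by (intro tendsto_norm assms)
  then have "((\<lambda>h. 1::real) \<longlongrightarrow> norm e) F"
    by (simp add: norm_sgn zero_prod_def)
  then show "norm e = 1"
    using assms(2) tendsto_const_iff by metis
  show "0 \<le> fst e"
    by (rule tendsto_lowerbound[OF tendsto_fst[OF assms(1)] _ assms(2)])
      (simp add: sgn_div_norm)
qed

lemma slope_eq_snd_div_fst_direction: "q = snd (direction q) / fst (direction q)" for q :: real
  by (simp add: sgn_div_norm zero_prod_def)

lemma tendsto_slope_of_direction:
  fixes q :: "'a \<Rightarrow> real"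
  assumes "((\<lambda>h. direction (q h)) \<longlongrightarrow> e) F" and "fst e \<noteq> 0"
  shows "(q \<longlongrightarrow> snd e / fst e) F"
  using tendsto_divide[OF tendsto_snd[OF assms(1)] tendsto_fst[OF assms(1)] assms(2)]
  by (simp flip: slope_eq_snd_div_fst_direction)

text \<open>
  Here \<open>q h\<close> is a quotient whose denominator tends to \<open>0\<close> through positive values, while the
  numerator tends to \<open>1\<close> or \<open>-1\<close>.
\<close>

lemma filterlim_slope_of_vertical_direction:
  fixes q :: "'a \<Rightarrow> real"
  assumes lim: "((\<lambda>h. direction (q h)) \<longlongrightarrow> e) F" and "F \<noteq> bot" and "fst e = 0"
  shows "filterlim q at_top F \<or> filterlim q at_bot F"
proof -
  have "\<bar>snd e\<bar> = 1"
    using tendsto_direction_limit(1)[OF lim \<open>F \<noteq> bot\<close>] \<open>fst e = 0\<close> by (simp add: norm_prod_def)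
  have "filterlim (\<lambda>h. fst (direction (q h))) (at_right 0) F"
    unfolding filterlim_at
    using tendsto_fst[OF lim] \<open>fst e = 0\<close>
    by (auto simp: sgn_div_norm zero_prod_def)
  then have inv: "filterlim (\<lambda>h. inverse (fst (direction (q h)))) at_top F"
    by (rule filterlim_compose[OF filterlim_inverse_at_top_right])
  have q: "(\<lambda>h. snd (direction (q h)) * inverse (fst (direction (q h)))) = q"
    by (simp flip: slope_eq_snd_div_fst_direction divide_inverse)
  consider "snd e > 0" | "snd e < 0"
    using \<open>\<bar>snd e\<bar> = 1\<close> by linarith
  then show ?thesis
  proof cases
    case 1
    from filterlim_tendsto_pos_mult_at_top[OF tendsto_snd[OF lim] this inv]
    show ?thesis unfolding q by simp
  next
    case 2
    from filterlim_tendsto_neg_mult_at_bot[OF tendsto_snd[OF lim] this inv]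
    show ?thesis unfolding q by simp
  qed
qed

section \<open>Limits along parts of a graph\<close>

lemma inj_on_fst_fun_graph: "inj_on fst (fun_graph S f)"
  by (auto simp: inj_on_def fun_graph_def)

lemma secant_direction:
  assumes "h \<noteq> 0"
  shows "sgn ((x0 + h, f (x0 + h)) - (x0, f x0)) = sgn h *\<^sub>R direction (diff_quot f x0 h)"
proof -
  have "(x0 + h, f (x0 + h)) - (x0, f x0) = h *\<^sub>R (1, diff_quot f x0 h)"
    using assms by (simp add: diff_quot_def)
  then show ?thesis by (simp only: sgn_scaleR real_scaleR_def)
qed

text \<open>
  The set \<open>J\<close> of increments will be an open half-line. The assumptions say that near \<open>A\<close> the set
  \<open>L\<close> is the part of the graph over increments in \<open>J\<close>, so that \<open>h \<mapsto> (x0 + h, f (x0 + h))\<close> and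
  \<open>M \<mapsto> fst M - x0\<close> are mutually inverse near the limit point.
\<close>

lemma tendsto_within_graph_iff:
  assumes graph: "L \<subseteq> fun_graph S f" and cont: "isCont f x0"
    and side: "\<And>M. M \<in> L \<Longrightarrow> M \<noteq> (x0, f x0) \<Longrightarrow> fst M - x0 \<in> J" and "0 \<notin> J"
    and over: "\<forall>\<^sub>F h in at 0 within J. x0 + h \<in> fst ` L"
  shows "(\<phi> \<longlongrightarrow> d) (at (x0, f x0) within L) \<longleftrightarrow>
         ((\<lambda>h. \<phi> (x0 + h, f (x0 + h))) \<longlongrightarrow> d) (at 0 within J)"
proof
  let ?A = "(x0, f x0)"
  assume lim: "(\<phi> \<longlongrightarrow> d) (at ?A within L)"
  have "((\<lambda>h. f (x0 + h)) \<longlongrightarrow> f x0) (at 0)"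
    using cont by (simp add: isCont_iff)
  then have "((\<lambda>h. f (x0 + h)) \<longlongrightarrow> f x0) (at 0 within J)"
    by (rule tendsto_within_subset) simp
  moreover have "((\<lambda>h. x0 + h) \<longlongrightarrow> x0) (at 0 within J)"
    by (auto intro!: tendsto_eq_intros)
  ultimately have "((\<lambda>h. (x0 + h, f (x0 + h))) \<longlongrightarrow> ?A) (at 0 within J)"
    by (intro tendsto_Pair)
  moreover have "\<forall>\<^sub>F h in at 0 within J. (x0 + h, f (x0 + h)) \<in> L \<and> (x0 + h, f (x0 + h)) \<noteq> ?A"
  proof -
    have "\<forall>\<^sub>F h in at 0 within J. h \<noteq> 0"
      by (simp add: eventually_at_filter)
    with over show ?thesis
    proof eventually_elim
      case (elim h)
      then obtain M where "M \<in> L" "fst M = x0 + h" by force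
      moreover from this have "snd M = f (x0 + h)"
        using graph by (auto simp: fun_graph_def)
      ultimately have "(x0 + h, f (x0 + h)) \<in> L"
        by (metis prod.collapse)
      then show ?case using elim by simp
    qed
  qed
  ultimately have "filterlim (\<lambda>h. (x0 + h, f (x0 + h))) (at ?A within L) (at 0 within J)"
    unfolding filterlim_at by blast
  from filterlim_compose[OF lim this]
  show "((\<lambda>h. \<phi> (x0 + h, f (x0 + h))) \<longlongrightarrow> d) (at 0 within J)" .
next
  let ?A = "(x0, f x0)"
  assume lim: "((\<lambda>h. \<phi> (x0 + h, f (x0 + h))) \<longlongrightarrow> d) (at 0 within J)"
  have "((\<lambda>M. fst M - x0) \<longlongrightarrow> fst ?A - x0) (at ?A within L)"
    by (intro tendsto_intros)
  moreover have "\<forall>\<^sub>F M in at ?A within L. fst M - x0 \<in> J \<and> fst M - x0 \<noteq> 0"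
    unfolding eventually_at_filter
    by (rule always_eventually) (use side \<open>0 \<notin> J\<close> in metis)
  ultimately have "filterlim (\<lambda>M. fst M - x0) (at 0 within J) (at ?A within L)"
    unfolding filterlim_at by simp
  from filterlim_compose[OF lim this]
  have "((\<lambda>M. \<phi> (fst M, f (fst M))) \<longlongrightarrow> d) (at ?A within L)" by simp
  moreover have "\<forall>\<^sub>F M in at ?A within L. \<phi> (fst M, f (fst M)) = \<phi> M"
    unfolding eventually_at_filter
    by (rule always_eventually) (use graph in \<open>auto simp: fun_graph_def\<close>)
  ultimately show "(\<phi> \<longlongrightarrow> d) (at ?A within L)"
    by (rule Lim_transform_eventually)
qed

lemma secant_limit_right_iff:
  assumes "L \<subseteq> fun_graph S f" and "isCont f x0" and "connected L"
    and "(x0, f x0) \<in> L" and "N \<in> L" and "N \<noteq> (x0, f x0)"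
    and right: "fst ` L \<subseteq> {x0..}"
  shows "((\<lambda>M. sgn (M - (x0, f x0))) \<longlongrightarrow> d) (at (x0, f x0) within L) \<longleftrightarrow>
         ((\<lambda>h. direction (diff_quot f x0 h)) \<longlongrightarrow> d) (at_right 0)"
proof -
  have apart: "fst M \<noteq> x0" if "M \<in> L" "M \<noteq> (x0, f x0)" for M
    using that assms(1) by (auto simp: fun_graph_def)
  have "x0 < fst N"
    using apart[of N] assms(5,6) right by force
  have I: "connected (fst ` L)"
    by (intro connected_continuous_image continuous_intros assms)
  have "\<forall>\<^sub>F h in at_right 0. x0 + h \<in> fst ` L"
    unfolding eventually_at_right_field
  proof (intro exI[of _ "fst N - x0"] conjI allI impI)
    show "0 < fst N - x0" using \<open>x0 < fst N\<close> by simp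
    show "x0 + h \<in> fst ` L" if "0 < h" "h < fst N - x0" for h
      by (rule connectedD_interval[OF I, of x0 "fst N"]) (use that assms(4,5) in force)+
  qed
  moreover have "fst M - x0 \<in> {0<..}" if "M \<in> L" "M \<noteq> (x0, f x0)" for M
    using apart[OF that] right that(1) by force
  ultimately have "((\<lambda>M. sgn (M - (x0, f x0))) \<longlongrightarrow> d) (at (x0, f x0) within L) \<longleftrightarrow>
      ((\<lambda>h. sgn ((x0 + h, f (x0 + h)) - (x0, f x0))) \<longlongrightarrow> d) (at_right 0)"
    by (intro tendsto_within_graph_iff[OF assms(1,2)]) auto
  also have "\<dots> \<longleftrightarrow> ((\<lambda>h. direction (diff_quot f x0 h)) \<longlongrightarrow> d) (at_right 0)"
    by (intro tendsto_cong eventually_mono[OF eventually_at_right_less])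
      (simp add: secant_direction del: diff_Pair)
  finally show ?thesis .
qed

lemma secant_limit_left_iff:
  assumes "L \<subseteq> fun_graph S f" and "isCont f x0" and "connected L"
    and "(x0, f x0) \<in> L" and "N \<in> L" and "N \<noteq> (x0, f x0)"
    and left: "fst ` L \<subseteq> {..x0}"
  shows "((\<lambda>M. sgn (M - (x0, f x0))) \<longlongrightarrow> d) (at (x0, f x0) within L) \<longleftrightarrow>
         ((\<lambda>h. direction (diff_quot f x0 h)) \<longlongrightarrow> - d) (at_left 0)"
proof -
  have apart: "fst M \<noteq> x0" if "M \<in> L" "M \<noteq> (x0, f x0)" for M
    using that assms(1) by (auto simp: fun_graph_def)
  have "fst N < x0"
    using apart[of N] assms(5,6) left by force
  have I: "connected (fst ` L)"
    by (intro connected_continuous_image continuous_intros assms)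
  have "\<forall>\<^sub>F h in at_left 0. x0 + h \<in> fst ` L"
    unfolding eventually_at_left_field
  proof (intro exI[of _ "fst N - x0"] conjI allI impI)
    show "fst N - x0 < 0" using \<open>fst N < x0\<close> by simp
    show "x0 + h \<in> fst ` L" if "fst N - x0 < h" "h < 0" for h
      by (rule connectedD_interval[OF I, of "fst N" x0]) (use that assms(4,5) in force)+
  qed
  moreover have "fst M - x0 \<in> {..<0}" if "M \<in> L" "M \<noteq> (x0, f x0)" for M
    using apart[OF that] left that(1) by force
  ultimately have "((\<lambda>M. sgn (M - (x0, f x0))) \<longlongrightarrow> d) (at (x0, f x0) within L) \<longleftrightarrow>
      ((\<lambda>h. sgn ((x0 + h, f (x0 + h)) - (x0, f x0))) \<longlongrightarrow> d) (at_left 0)"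
    by (intro tendsto_within_graph_iff[OF assms(1,2)]) auto
  also have "\<dots> \<longleftrightarrow> ((\<lambda>h. - direction (diff_quot f x0 h)) \<longlongrightarrow> d) (at_left 0)"
    by (intro tendsto_cong)
      (simp add: secant_direction eventually_at_filter del: diff_Pair)
  also have "\<dots> \<longleftrightarrow> ((\<lambda>h. direction (diff_quot f x0 h)) \<longlongrightarrow> - d) (at_left 0)"
    by (subst tendsto_minus_cancel_left[symmetric]) simp
  finally show ?thesis .
qed

section \<open>Tangents of a graph\<close>

lemma intervals_meeting_in_point:
  fixes I1 I2 :: "real set"
  assumes "connected I1" and "connected I2" and meet: "I1 \<inter> I2 = {c}"
    and "p1 \<in> I1" "p1 \<noteq> c" and "p2 \<in> I2" "p2 \<noteq> c"
  shows "I1 \<subseteq> {c..} \<and> I2 \<subseteq> {..c} \<or> I1 \<subseteq> {..c} \<and> I2 \<subseteq> {c..}"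
proof -
  have c: "c \<in> I1" "c \<in> I2" using meet by auto
  \<comment> \<open>Points on the same side of \<open>c\<close> would make the nearer one a second common point.\<close>
  have right: False if "x \<in> I1" "y \<in> I2" "c < x" "c < y" for x y
  proof -
    have "min x y \<in> I1"
      by (rule connectedD_interval[OF assms(1) c(1) that(1)]) (use that in auto)
    moreover have "min x y \<in> I2"
      by (rule connectedD_interval[OF assms(2) c(2) that(2)]) (use that in auto)
    ultimately have "min x y = c" using meet by blast
    then show False using that by linarith
  qed
  have left: False if "x \<in> I1" "y \<in> I2" "x < c" "y < c" for x y
  proof -
    have "max x y \<in> I1"
      by (rule connectedD_interval[OF assms(1) that(1) c(1)]) (use that in auto)
    moreover have "max x y \<in> I2"
      by (rule connectedD_interval[OF assms(2) that(2) c(2)]) (use that in auto)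
    ultimately have "max x y = c" using meet by blast
    then show False using that by linarith
  qed
  show ?thesis
  proof (cases "c < p1")
    case True
    then have 1: "I2 \<subseteq> {..c}"
      using right[OF \<open>p1 \<in> I1\<close>] by force
    then have "p2 < c"
      using \<open>p2 \<in> I2\<close> \<open>p2 \<noteq> c\<close> by force
    then have "I1 \<subseteq> {c..}"
      using left[OF _ \<open>p2 \<in> I2\<close>] by force
    with 1 show ?thesis by blast
  next
    case False
    then have "p1 < c" using \<open>p1 \<noteq> c\<close> by simp
    then have 1: "I2 \<subseteq> {c..}"
      using left[OF \<open>p1 \<in> I1\<close>] by force
    then have "c < p2"
      using \<open>p2 \<in> I2\<close> \<open>p2 \<noteq> c\<close> by force
    then have "I1 \<subseteq> {..c}"
      using right[OF _ \<open>p2 \<in> I2\<close>] by force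
    with 1 show ?thesis by blast
  qed
qed

lemma collinear_unit_vectors:
  fixes u v :: "'a::real_normed_vector"
  assumes "collinear {0, u, v}" and "norm u = 1" and "norm v = 1"
  shows "v = u \<or> v = - u"
proof -
  have "u \<noteq> 0" "v \<noteq> 0" using assms by auto
  then obtain c where "v = c *\<^sub>R u"
    using assms(1) by (auto simp: collinear_lemma)
  moreover from this have "\<bar>c\<bar> = 1" using assms by simp
  ultimately show ?thesis by (auto simp: abs_if split: if_splits)
qed

lemma line_through_scaleR:
  assumes "c \<noteq> 0"
  shows "line_through P (c *\<^sub>R d) = line_through P d"
proof -
  have "\<exists>t. P + s *\<^sub>R d = P + t *\<^sub>R c *\<^sub>R d" for s
    by (rule exI[of _ "s / c"]) (use assms in simp)
  moreover have "\<exists>t. P + s *\<^sub>R c *\<^sub>R d = P + t *\<^sub>R d" for s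
    by (rule exI[of _ "s * c"]) simp
  ultimately show ?thesis unfolding line_through_def by blast
qed

lemma line_through_minus: "line_through P (- d) = line_through P d"
  using line_through_scaleR[of "-1" P d] by simp

text \<open>
  For the existence of a tangent the arc is the graph over a small interval centred at \<open>x0\<close>, run
  through at constant horizontal speed.
\<close>

lemma is_tangent_graph_iff:
  fixes f :: "real \<Rightarrow> real"
  assumes "open U" and "x0 \<in> U" and "U \<subseteq> S" and "continuous_on U f"
  shows "is_tangent (fun_graph S f) (x0, f x0) T \<longleftrightarrow>
    (\<exists>e. ((\<lambda>h. direction (diff_quot f x0 h)) \<longlongrightarrow> e) (at_right 0) \<and>
         (((\<lambda>h. direction (diff_quot f x0 h)) \<longlongrightarrow> e) (at_left 0) \<or>
          ((\<lambda>h. direction (diff_quot f x0 h)) \<longlongrightarrow> - e) (at_left 0)) \<and>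
         T = line_through (x0, f x0) e)"
    (is "_ \<longleftrightarrow> (\<exists>e. ?R e \<and> (?L e \<or> ?L (- e)) \<and> _ e)")
proof
  let ?G = "fun_graph S f" and ?A = "(x0, f x0)"
  have cont: "isCont f x0"
    using assms continuous_on_eq_continuous_at by blast
  assume "is_tangent ?G ?A T"
  then obtain g t d1 d2 d where
    g: "path g" "path_image g \<subseteq> ?G" and t: "t \<in> {0..1}" "g t = ?A" and
    meet: "g ` {0..t} \<inter> g ` {t..1} = {?A}" and
    points: "\<exists>M\<in>g ` {0..t}. M \<noteq> ?A" "\<exists>M\<in>g ` {t..1}. M \<noteq> ?A" and
    lim1: "((\<lambda>M. sgn (M - ?A)) \<longlongrightarrow> d1) (at ?A within g ` {0..t})" and
    lim2: "((\<lambda>M. sgn (M - ?A)) \<longlongrightarrow> d2) (at ?A within g ` {t..1})" and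
    col: "collinear {0, d1, d2}" and d: "d \<in> {d1, d2}" and T: "T = line_through ?A d"
    unfolding is_tangent_def sgn_div_norm by blast
  define L1 L2 where "L1 = g ` {0..t}" and "L2 = g ` {t..1}"
  note meet = meet[folded L1_def L2_def] and points = points[folded L1_def L2_def]
    and lim1 = lim1[folded L1_def L2_def] and lim2 = lim2[folded L1_def L2_def]
  have G: "L1 \<subseteq> ?G" "L2 \<subseteq> ?G"
    using g(2) t(1) by (auto simp: L1_def L2_def path_image_def)
  have "continuous_on {0..1} g" using g(1) by (simp add: path_def)
  then have conn: "connected L1" "connected L2"
    using t(1) unfolding L1_def L2_def
    by (auto intro!: connected_continuous_image elim: continuous_on_subset)
  have A: "?A \<in> L1" "?A \<in> L2" using meet by auto
  obtain N1 N2 where N1: "N1 \<in> L1" "N1 \<noteq> ?A" and N2: "N2 \<in> L2" "N2 \<noteq> ?A"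
    using points by blast
  have "fst ` L1 \<inter> fst ` L2 = {x0}"
    using inj_on_image_Int[OF inj_on_fst_fun_graph G] meet by simp
  moreover have "fst N1 \<noteq> x0" "fst N2 \<noteq> x0"
    using N1 N2 G by (auto simp: fun_graph_def)
  moreover have "connected (fst ` L1)" "connected (fst ` L2)"
    by (intro connected_continuous_image continuous_intros conn)+
  ultimately have sides:
    "fst ` L1 \<subseteq> {x0..} \<and> fst ` L2 \<subseteq> {..x0} \<or> fst ` L1 \<subseteq> {..x0} \<and> fst ` L2 \<subseteq> {x0..}"
    by (intro intervals_meeting_in_point[where ?p1.0 = "fst N1" and ?p2.0 = "fst N2"])
      (use N1 N2 in auto)
  have "(?R d1 \<and> ?L (- d2)) \<or> (?R d2 \<and> ?L (- d1))"
    using sides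
  proof
    assume s: "fst ` L1 \<subseteq> {x0..} \<and> fst ` L2 \<subseteq> {..x0}"
    show ?thesis
      using lim1 lim2 secant_limit_right_iff[OF G(1) cont conn(1) A(1) N1 s[THEN conjunct1]]
        secant_limit_left_iff[OF G(2) cont conn(2) A(2) N2 s[THEN conjunct2]] by blast
  next
    assume s: "fst ` L1 \<subseteq> {..x0} \<and> fst ` L2 \<subseteq> {x0..}"
    show ?thesis
      using lim1 lim2 secant_limit_left_iff[OF G(1) cont conn(1) A(1) N1 s[THEN conjunct1]]
        secant_limit_right_iff[OF G(2) cont conn(2) A(2) N2 s[THEN conjunct2]] by blast
  qed
  moreover have "d2 = d1 \<or> d2 = - d1"
    by (rule collinear_unit_vectors[OF col])
      (use calculation tendsto_direction_limit(1) in
        \<open>metis norm_minus_cancel trivial_limit_at_left_real trivial_limit_at_right_real\<close>)+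
  ultimately show "\<exists>e. ?R e \<and> (?L e \<or> ?L (- e)) \<and> T = line_through ?A e"
    using d T line_through_minus[of ?A d1] by (metis empty_iff insert_iff minus_minus)
next
  let ?G = "fun_graph S f" and ?A = "(x0, f x0)"
  have cont: "isCont f x0"
    using assms continuous_on_eq_continuous_at by blast
  assume "\<exists>e. ?R e \<and> (?L e \<or> ?L (- e)) \<and> T = line_through ?A e"
  then obtain e where R: "?R e" and L: "?L e \<or> ?L (- e)" and T: "T = line_through ?A e"
    by blast
  \<comment> \<open>Secants to the left point against \<open>direction\<close>, so along the left part they tend to \<open>d2\<close>.\<close>
  from L obtain d2 where L: "?L (- d2)" and d2: "d2 = e \<or> d2 = - e"
    by (metis minus_minus)
  obtain r where r: "r > 0" "cball x0 r \<subseteq> U"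
    using assms(1,2) open_contains_cball by metis
  define u where "u = (\<lambda>s. x0 + (2 * s - 1) * r)"
  define g where "g = (\<lambda>s. (u s, f (u s)))"
  have "u s \<in> U" if "s \<in> {0..1}" for s
  proof -
    have "\<bar>2 * s - 1\<bar> * r \<le> 1 * r"
      by (rule mult_right_mono) (use that r in auto)
    then have "u s \<in> cball x0 r"
      using r(1) by (simp add: u_def dist_real_def abs_mult)
    then show ?thesis using r(2) by blast
  qed
  then have u: "u ` {0..1} \<subseteq> U" by blast
  have "continuous_on {0..1} (\<lambda>s. f (u s))"
    by (rule continuous_on_compose2[OF assms(4) _ u]) (auto simp: u_def intro!: continuous_intros)
  then have g_cont: "continuous_on {0..1} g"
    unfolding g_def by (intro continuous_on_Pair) (auto simp: u_def intro!: continuous_intros)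
  have g_graph: "g ` {0..1} \<subseteq> ?G"
    using u assms(3) by (auto simp: g_def fun_graph_def)
  have mid: "g (1/2) = ?A" by (simp add: g_def u_def)
  have inj: "s = s'" if "g s = g s'" for s s'
    using that r(1) by (simp add: g_def u_def)
  let ?L1 = "g ` {0..1/2}" and ?L2 = "g ` {1/2..1}"
  have A: "?A \<in> ?L1" "?A \<in> ?L2"
    using mid by (auto intro!: image_eqI[of _ _ "1/2"])
  have N1: "g 0 \<in> ?L1" "g 0 \<noteq> ?A" and N2: "g 1 \<in> ?L2" "g 1 \<noteq> ?A"
    using inj[of 0 "1/2"] inj[of 1 "1/2"] mid by auto
  have "?L1 \<inter> ?L2 = {?A}"
  proof (intro equalityI subsetI)
    fix M assume "M \<in> ?L1 \<inter> ?L2"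
    then obtain s s' where ss: "s \<in> {0..1/2}" "s' \<in> {1/2..1}" "M = g s" "M = g s'" by blast
    then have "s = 1/2" using inj[of s s'] by auto
    then show "M \<in> {?A}" using mid ss(3) by blast
  qed (use A in auto)
  moreover have G: "?L1 \<subseteq> ?G" "?L2 \<subseteq> ?G"
    using g_graph by auto
  have conn: "connected ?L1" "connected ?L2"
    by (auto intro!: connected_continuous_image continuous_on_subset[OF g_cont])
  have "fst ` ?L1 \<subseteq> {..x0}"
    using r(1) by (auto simp: g_def u_def mult_le_0_iff)
  with secant_limit_left_iff[OF G(1) cont conn(1) A(1) N1] L
  have "((\<lambda>M. sgn (M - ?A)) \<longlongrightarrow> d2) (at ?A within ?L1)" by blast
  moreover have "fst ` ?L2 \<subseteq> {x0..}"
    using r(1) by (auto simp: g_def u_def zero_le_mult_iff)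
  with secant_limit_right_iff[OF G(2) cont conn(2) A(2) N2] R
  have "((\<lambda>M. sgn (M - ?A)) \<longlongrightarrow> e) (at ?A within ?L2)" by blast
  moreover have "collinear {0, d2, e}"
    using d2 by (auto simp: collinear_lemma intro: exI[of _ "-1"] exI[of _ 1])
  moreover have "path g" "path_image g \<subseteq> ?G" "1/2 \<in> {0..1::real}"
    using g_cont g_graph by (auto simp: path_def path_image_def)
  moreover have "\<exists>M\<in>?L1. M \<noteq> ?A" "\<exists>M\<in>?L2. M \<noteq> ?A"
    using N1 N2 by blast+
  moreover have "e \<in> {d2, e}" by simp
  ultimately show "is_tangent ?G ?A T"
    unfolding is_tangent_def sgn_div_norm
    by - (rule exI[of _ g], rule exI[of _ "1/2"], rule exI[of _ ?L1], rule exI[of _ ?L2],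
        rule exI[of _ d2], rule exI[of _ e], rule exI[of _ e], intro conjI,
        (assumption | rule refl mid T)+)
qed

section \<open>Tangents and extended derivatives\<close>

lemma has_slope_line_through:
  assumes "e = direction l"
  shows "has_slope (line_through P e) (Finite l)"
proof -
  have "line_through P e = line_through P (1, l)"
    unfolding assms sgn_div_norm by (rule line_through_scaleR) (simp add: zero_prod_def)
  then show ?thesis unfolding has_slope.simps by blast
qed

lemma ext_differentiable_of_unit_limits:
  assumes R: "((\<lambda>h. direction (diff_quot f x0 h)) \<longlongrightarrow> e) (at_right 0)"
    and L: "((\<lambda>h. direction (diff_quot f x0 h)) \<longlongrightarrow> e) (at_left 0) \<or>
            ((\<lambda>h. direction (diff_quot f x0 h)) \<longlongrightarrow> - e) (at_left 0)"
  shows "ext_differentiable f x0"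
proof (cases "fst e = 0")
  case True
  with R have "filterlim (diff_quot f x0) at_top (at_right 0) \<or>
      filterlim (diff_quot f x0) at_bot (at_right 0)"
    by (intro filterlim_slope_of_vertical_direction) auto
  moreover have "filterlim (diff_quot f x0) at_top (at_left 0) \<or>
      filterlim (diff_quot f x0) at_bot (at_left 0)"
    using L True filterlim_slope_of_vertical_direction[of "diff_quot f x0" _ "at_left 0"]
    by (metis fst_uminus minus_zero trivial_limit_at_left_real)
  ultimately have "has_ext_derivative f Infinite x0" by simp
  then show ?thesis unfolding ext_differentiable_def by blast
next
  case False
  \<comment> \<open>All directions lie in the right half-plane, so the limit on the left is not \<open>- e\<close>.\<close>
  have "0 < fst e"
    using tendsto_direction_limit(2)[OF R] False by simp
  then have "((\<lambda>h. direction (diff_quot f x0 h)) \<longlongrightarrow> e) (at_left 0)"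
    using L tendsto_direction_limit(2)[of "diff_quot f x0" "- e" "at_left 0"] by auto
  then have "(diff_quot f x0 \<longlongrightarrow> snd e / fst e) (at 0)"
    using R False by (simp add: filterlim_split_at tendsto_slope_of_direction)
  then have "has_ext_derivative f (Finite (snd e / fst e)) x0" by simp
  then show ?thesis unfolding ext_differentiable_def by blast
qed

lemma unit_limits_of_ext_derivative:
  assumes "has_ext_derivative f m x0"
  obtains e where "((\<lambda>h. direction (diff_quot f x0 h)) \<longlongrightarrow> e) (at_right 0)"
    and "((\<lambda>h. direction (diff_quot f x0 h)) \<longlongrightarrow> e) (at_left 0) \<or>
         ((\<lambda>h. direction (diff_quot f x0 h)) \<longlongrightarrow> - e) (at_left 0)"
    and "has_slope (line_through P e) m"
proof (cases m)
  case (Finite l)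
  then have "((\<lambda>h. direction (diff_quot f x0 h)) \<longlongrightarrow> direction l) (at 0)"
    using assms by (simp add: tendsto_direction)
  then show thesis
    using that has_slope_line_through[OF refl, of P l] Finite unfolding filterlim_at_split by blast
next
  case Infinite
  let ?v = "\<lambda>h. direction (diff_quot f x0 h)"
  have one_sided: "(?v \<longlongrightarrow> (0, 1)) F \<or> (?v \<longlongrightarrow> - (0, 1)) F"
    if "filterlim (diff_quot f x0) at_top F \<or> filterlim (diff_quot f x0) at_bot F" for F
    using that tendsto_direction_at_top tendsto_direction_at_bot by auto
  obtain e where e: "e = (0, 1) \<or> e = - (0, 1)" "(?v \<longlongrightarrow> e) (at_right 0)"
    using assms Infinite one_sided[of "at_right 0"] by auto
  have "(?v \<longlongrightarrow> (0, 1)) (at_left 0) \<or> (?v \<longlongrightarrow> - (0, 1)) (at_left 0)"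
    using assms Infinite one_sided[of "at_left 0"] by auto
  then have "(?v \<longlongrightarrow> e) (at_left 0) \<or> (?v \<longlongrightarrow> - e) (at_left 0)"
    using e(1) by auto
  moreover have "line_through P e = line_through P (0, 1)"
    using e(1) line_through_minus[of P "(0, 1)"] by auto
  then have "has_slope (line_through P e) Infinite"
    unfolding has_slope.simps by blast
  ultimately show thesis
    using that[OF e(2)] Infinite by blast
qed

text \<open>
  The slope is determined by the limit \<open>e\<close> on the right alone, and that limit is unique; so the
  direction of any tangent is the one computed from any extended derivative.
\<close>

theorem corollary3p5:
  fixes f :: "real \<Rightarrow> real" and S U :: "real set" and x0 :: real
  assumes "open U" and "x0 \<in> U" and "U \<subseteq> S" and "continuous_on U f"
  shows "(has_tangent (fun_graph S f) (x0, f x0) \<longleftrightarrow> ext_differentiable f x0) \<and>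
         (\<forall>T m. is_tangent (fun_graph S f) (x0, f x0) T \<and> has_ext_derivative f m x0
                 \<longrightarrow> has_slope T m)"
proof (intro conjI allI impI iffI)
  note tangent_iff = is_tangent_graph_iff[OF assms]
  show "ext_differentiable f x0" if "has_tangent (fun_graph S f) (x0, f x0)"
    using that ext_differentiable_of_unit_limits unfolding has_tangent_def tangent_iff by blast
  show "has_tangent (fun_graph S f) (x0, f x0)" if diff: "ext_differentiable f x0"
  proof -
    obtain m where "has_ext_derivative f m x0"
      using diff unfolding ext_differentiable_def by blast
    then show ?thesis
      unfolding has_tangent_def tangent_iff
      by (rule unit_limits_of_ext_derivative) blast
  qed
  show "has_slope T m"
    if asm: "is_tangent (fun_graph S f) (x0, f x0) T \<and> has_ext_derivative f m x0" for T m
  proof -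
    obtain e where e: "((\<lambda>h. direction (diff_quot f x0 h)) \<longlongrightarrow> e) (at_right 0)"
      and T: "T = line_through (x0, f x0) e"
      using asm tangent_iff by blast
    obtain e' where e': "((\<lambda>h. direction (diff_quot f x0 h)) \<longlongrightarrow> e') (at_right 0)"
      and slope: "has_slope (line_through (x0, f x0) e') m"
      by (rule unit_limits_of_ext_derivative[OF asm[THEN conjunct2]])
    have "e = e'"
      by (rule tendsto_unique[OF _ e e']) simp
    then show ?thesis using T slope by simp
  qed
qed

end
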